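(* Let $C=(C_{i,j})$ and $D=(D_{i,j})$ be $n\times n$ matrices with strictly positive entries, and let $A$ be their entrywise product, $A_{i,j}=C_{i,j}D_{i,j}$. Let $\Omega_n$ denote the set of $n\times n$ doubly stochastic matrices (non-negative entries, all row and column sums equal to $1$). Define the $n^2$-variate polynomials $p(x)=\prod_{i=1}^n\sum_{j=1}^n x_{i,j}C_{i,j}$ and $q(y)=\prod_{j=1}^n\sum_{i=1}^n y_{i,j}D_{i,j}$, and $$R_Q(A)=\sup_{B\in\Omega_n}\ \inf_{x,y\in\mathbb{R}^{n\times n}_{>0}}\frac{p(x)\,q(y)\prod_{i,j}B_{i,j}^{B_{i,j}}\prod_{i,j}(1-B_{i,j})^{1-B_{i,j}}}{\prod_{i,j}(x_{i,j}y_{i,j})^{B_{i,j}}},$$ and $$R_O(A)=\sup_{B\in\Omega_n}\sum_{i,j=1}^n\Big(B_{i,j}\log\frac{A_{i,j}}{B_{i,j}}+(1-B_{i,j})\log(1-B_{i,j})\Big),$$ with conventions $0^0=1$, $0\log 0=0$ and $0\log\frac{a}{0}=0$. Then $R_Q(A)=\exp(R_O(A))$. *)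

theory Defs
  imports "HOL-Analysis.Analysis"
begin

definition pos_matrices :: "(real^'n^'n) set" where
  "pos_matrices = {x. \<forall>i j. 0 < x$i$j}"

definition doubly_stochastic :: "(real^'n^'n) set" where
  "doubly_stochastic = {B. (\<forall>i j. 0 \<le> B$i$j) \<and>
     (\<forall>i. (\<Sum>j\<in>UNIV. B$i$j) = 1) \<and> (\<forall>j. (\<Sum>i\<in>UNIV. B$i$j) = 1)}"

definition row_poly :: "real^'n^'n \<Rightarrow> real^'n^'n \<Rightarrow> real" where
  "row_poly C x = (\<Prod>i\<in>UNIV. \<Sum>j\<in>UNIV. x$i$j * C$i$j)"

definition col_poly :: "real^'n^'n \<Rightarrow> real^'n^'n \<Rightarrow> real" where
  "col_poly D y = (\<Prod>j\<in>UNIV. \<Sum>i\<in>UNIV. y$i$j * D$i$j)"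

text \<open>The power \<open>b\<^sup>e\<close> with the convention \<open>0\<^sup>0 = 1\<close>; the library has \<open>0 powr 0 = 0\<close>.\<close>

definition rpow :: "real \<Rightarrow> real \<Rightarrow> real" where
  "rpow b e = (if b = 0 \<and> e = 0 then 1 else b powr e)"

definition RQ_ratio ::
    "real^'n^'n \<Rightarrow> real^'n^'n \<Rightarrow> real^'n^'n \<Rightarrow> real^'n^'n \<Rightarrow> real^'n^'n \<Rightarrow> real" where
  "RQ_ratio C D B x y =
     row_poly C x * col_poly D y
       * (\<Prod>i\<in>UNIV. \<Prod>j\<in>UNIV. rpow (B$i$j) (B$i$j))
       * (\<Prod>i\<in>UNIV. \<Prod>j\<in>UNIV. rpow (1 - B$i$j) (1 - B$i$j))
     / (\<Prod>i\<in>UNIV. \<Prod>j\<in>UNIV. rpow (x$i$j * y$i$j) (B$i$j))"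

text \<open>The supremum and infimum here and below are taken in the reals. This is legitimate: the sets
  involved are nonempty and bounded on the relevant side, see the lemmas at the end.\<close>

definition R_Q :: "real^'n^'n \<Rightarrow> real^'n^'n \<Rightarrow> real" where
  "R_Q C D = (SUP B\<in>doubly_stochastic.
     INF (x, y)\<in>pos_matrices \<times> pos_matrices. RQ_ratio C D B x y)"

text \<open>The conventions \<open>0 log 0 = 0\<close> and \<open>0 log (a/0) = 0\<close> hold automatically,
  as \<^const>\<open>ln\<close> and division are total functions and \<open>0 * t = 0\<close>.\<close>

definition RO_sum :: "real^'n^'n \<Rightarrow> real^'n^'n \<Rightarrow> real" where
  "RO_sum A B = (\<Sum>i\<in>UNIV. \<Sum>j\<in>UNIV.
     B$i$j * ln (A$i$j / B$i$j) + (1 - B$i$j) * ln (1 - B$i$j))"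

definition R_O :: "real^'n^'n \<Rightarrow> real" where
  "R_O A = (SUP B\<in>doubly_stochastic. RO_sum A B)"


lemma pos_matrices_nonempty: "(pos_matrices :: (real^'n^'n) set) \<noteq> {}"
proof -
  have "(\<chi> i j. 1) \<in> (pos_matrices :: (real^'n^'n) set)"
    by (simp add: pos_matrices_def)
  then show ?thesis by blast
qed

lemma doubly_stochastic_nonempty: "(doubly_stochastic :: (real^'n^'n) set) \<noteq> {}"
proof -
  have "(\<chi> i j. 1 / real CARD('n)) \<in> (doubly_stochastic :: (real^'n^'n) set)"
    by (simp add: doubly_stochastic_def)
  then show ?thesis by blast
qed

lemma doubly_stochastic_le_1:
  fixes B :: "real^'n^'n"
  assumes "B \<in> doubly_stochastic"
  shows "B$i$j \<le> 1"
proof -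
  have "B$i$j \<le> (\<Sum>j\<in>UNIV. B$i$j)"
    using assms by (intro member_le_sum) (auto simp: doubly_stochastic_def)
  then show ?thesis using assms by (simp add: doubly_stochastic_def)
qed

lemma rpow_nonneg: "0 \<le> rpow b e"
  by (simp add: rpow_def)

lemma rpow_self_le_1: "0 \<le> b \<Longrightarrow> b \<le> 1 \<Longrightarrow> rpow b b \<le> 1"
  by (auto simp: rpow_def powr_le1)

lemma row_poly_nonneg:
  assumes "C \<in> pos_matrices" "x \<in> pos_matrices"
  shows "0 \<le> row_poly C x"
  using assms unfolding row_poly_def pos_matrices_def
  by (auto intro!: prod_nonneg sum_nonneg mult_nonneg_nonneg simp: less_imp_le)

lemma col_poly_nonneg:
  assumes "D \<in> pos_matrices" "y \<in> pos_matrices"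
  shows "0 \<le> col_poly D y"
  using assms unfolding col_poly_def pos_matrices_def
  by (auto intro!: prod_nonneg sum_nonneg mult_nonneg_nonneg simp: less_imp_le)

lemma RQ_ratio_nonneg:
  assumes "C \<in> pos_matrices" "D \<in> pos_matrices" "x \<in> pos_matrices" "y \<in> pos_matrices"
  shows "0 \<le> RQ_ratio C D B x y"
  unfolding RQ_ratio_def
  by (intro divide_nonneg_nonneg mult_nonneg_nonneg prod_nonneg row_poly_nonneg
      col_poly_nonneg rpow_nonneg ballI assms)

lemma RQ_ratio_bdd_below:
  assumes "C \<in> pos_matrices" "D \<in> pos_matrices"
  shows "bdd_below ((\<lambda>(x, y). RQ_ratio C D B x y) ` (pos_matrices \<times> pos_matrices))"
  using assms by (intro bdd_belowI[of _ 0]) (auto intro: RQ_ratio_nonneg)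

lemma RQ_bdd_above:
  fixes C D :: "real^'n^'n"
  assumes C: "C \<in> pos_matrices" and D: "D \<in> pos_matrices"
  shows "bdd_above ((\<lambda>B. INF (x, y)\<in>pos_matrices \<times> pos_matrices. RQ_ratio C D B x y)
           ` doubly_stochastic)"
proof (rule bdd_aboveI2)
  fix B :: "real^'n^'n" assume B: "B \<in> doubly_stochastic"
  define e :: "real^'n^'n" where "e = (\<chi> i j. 1)"
  have e: "e \<in> pos_matrices" by (simp add: e_def pos_matrices_def)
  have le: "B$i$j \<le> 1" and ge: "0 \<le> B$i$j" for i j
    using doubly_stochastic_le_1[OF B] B by (auto simp: doubly_stochastic_def)
  have 1: "(\<Prod>i\<in>UNIV. \<Prod>j\<in>UNIV. rpow (e$i$j * e$i$j) (B$i$j)) = 1"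
    by (simp add: e_def rpow_def)
  have 2: "(\<Prod>i\<in>UNIV. \<Prod>j\<in>UNIV. rpow (f i j) (f i j)) \<le> 1"
    if "\<And>i j. 0 \<le> f i j" "\<And>i j. f i j \<le> 1" for f :: "'n \<Rightarrow> 'n \<Rightarrow> real"
    by (intro prod_le_1 conjI prod_nonneg rpow_nonneg rpow_self_le_1 ballI that)
  have "(INF (x, y)\<in>pos_matrices \<times> pos_matrices. RQ_ratio C D B x y) \<le> RQ_ratio C D B e e"
    using cINF_lower[OF RQ_ratio_bdd_below[OF C D], of "(e, e)"] e by simp
  also have "\<dots> \<le> row_poly C e * col_poly D e * 1 * 1"
    unfolding RQ_ratio_def 1 div_by_1
    by (intro mult_mono order_refl 2 mult_nonneg_nonneg row_poly_nonneg
        col_poly_nonneg prod_nonneg rpow_nonneg C D e ballI ge) (simp_all add: le ge)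
  finally show "(INF (x, y)\<in>pos_matrices \<times> pos_matrices. RQ_ratio C D B x y)
      \<le> row_poly C (\<chi> i j. 1) * col_poly D (\<chi> i j. 1)"
    by (simp add: e_def)
qed

lemma RO_bdd_above:
  fixes A :: "real^'n^'n"
  assumes A: "A \<in> pos_matrices"
  shows "bdd_above (RO_sum A ` doubly_stochastic)"
proof (rule bdd_aboveI2)
  fix B :: "real^'n^'n" assume B: "B \<in> doubly_stochastic"
  have "B$i$j * ln (A$i$j / B$i$j) + (1 - B$i$j) * ln (1 - B$i$j) \<le> A$i$j" for i j
  proof -
    have le: "B$i$j \<le> 1" and ge: "0 \<le> B$i$j" and a: "0 < A$i$j"
      using doubly_stochastic_le_1[OF B] B A
      by (auto simp: doubly_stochastic_def pos_matrices_def)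
    have "B$i$j * ln (A$i$j / B$i$j) \<le> A$i$j"
    proof (cases "B$i$j = 0")
      case False
      then have "ln (A$i$j / B$i$j) \<le> A$i$j / B$i$j"
        using ge a by (intro ln_bound) simp
      then show ?thesis using False ge by (simp add: field_simps)
    qed (use a in simp)
    moreover have "(1 - B$i$j) * ln (1 - B$i$j) \<le> 0"
    proof (cases "B$i$j = 1")
      case False
      then show ?thesis using le ge by (intro mult_nonneg_nonpos) auto
    qed simp
    ultimately show ?thesis by linarith
  qed
  then show "RO_sum A B \<le> (\<Sum>i\<in>UNIV. \<Sum>j\<in>UNIV. A$i$j)"
    unfolding RO_sum_def by (intro sum_mono)
qed

end

theory Submission
  imports Defs
begin

text \<open>For a fixed doubly stochastic \<open>B\<close> the infimum over \<open>x, y\<close> can be evaluated: taking logarithms,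
  Gibbs' inequality applied to every row of \<open>x\<close> and every column of \<open>y\<close> shows that the ratio is at
  least the exponential of the entropy expression \<open>RO_sum A B\<close>. The formal minimisers
  \<open>x\<^sub>i\<^sub>j = B\<^sub>i\<^sub>j / C\<^sub>i\<^sub>j\<close> and \<open>y\<^sub>i\<^sub>j = B\<^sub>i\<^sub>j / D\<^sub>i\<^sub>j\<close> need not be positive, but adding \<open>e > 0\<close> to
  every \<open>B\<^sub>i\<^sub>j\<close> costs at most a factor \<open>exp (2n\<^sup>2e)\<close>. Finally \<open>exp\<close>, being continuous and
  increasing, commutes with the supremum over \<open>B\<close>.\<close>

text \<open>Weighting \<open>ln t \<le> t - 1\<close> at \<open>t = a j / (b j * S)\<close> by
  \<open>b j\<close> gives linear bounds \<open>a j / S - b j\<close>. Their sum over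
  \<open>j\<close> is \<open>1 - 1 = 0\<close>, so only \<open>ln S\<close> is left.\<close>

lemma gibbs_ln_sum:
  fixes a b :: "'n::finite \<Rightarrow> real"
  assumes a: "\<And>j. 0 < a j" and b: "\<And>j. 0 \<le> b j" and b1: "(\<Sum>j\<in>UNIV. b j) = 1"
  shows "(\<Sum>j\<in>UNIV. b j * (ln (a j) - ln (b j))) \<le> ln (\<Sum>j\<in>UNIV. a j)"
proof -
  define S where "S = (\<Sum>j\<in>UNIV. a j)"
  have S: "0 < S" unfolding S_def using a by (intro sum_pos) auto
  \<comment> \<open>Where \<open>b j = 0\<close> the left side vanishes, so \<open>ln 0\<close>
    never matters.\<close>
  have "b j * (ln (a j) - ln (b j)) \<le> a j / S - b j + b j * ln S" for j
  proof (cases "b j = 0")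
    case True
    then show ?thesis using a[of j] S by simp
  next
    case False
    then have bj: "0 < b j" using b[of j] by simp
    have "ln (a j / (b j * S)) \<le> a j / (b j * S) - 1"
      using a[of j] bj S by (intro ln_le_minus_one) simp
    moreover have "ln (a j / (b j * S)) = ln (a j) - ln (b j) - ln S"
      using a[of j] bj S by (simp add: ln_div ln_mult)
    ultimately have "b j * (ln (a j) - ln (b j) - ln S) \<le> b j * (a j / (b j * S) - 1)"
      using bj by (intro mult_left_mono) auto
    also have "\<dots> = a j / S - b j"
      using bj S by (simp add: field_simps)
    finally show ?thesis by (simp add: algebra_simps)
  qed
  then have "(\<Sum>j\<in>UNIV. b j * (ln (a j) - ln (b j))) \<le> (\<Sum>j\<in>UNIV. a j / S - b j + b j * ln S)"
    by (intro sum_mono)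
  also have "\<dots> = (\<Sum>j\<in>UNIV. a j) / S - (\<Sum>j\<in>UNIV. b j) + (\<Sum>j\<in>UNIV. b j) * ln S"
    by (simp add: sum.distrib sum_subtractf sum_divide_distrib sum_distrib_right)
  also have "\<dots> = ln S"
    using S b1 by (simp flip: S_def)
  finally show ?thesis by (simp add: S_def)
qed

text \<open>The alternative \<open>b = e\<close> serves the powers of \<open>B$i$j\<close> and
  \<open>1 - B$i$j\<close> to themselves: at zero the convention gives 1, which is
  \<open>exp (0 * ln 0)\<close>.\<close>

lemma rpow_eq_exp:
  assumes "0 < b \<or> b = e"
  shows "rpow b e = exp (e * ln b)"
  using assms by (auto simp: rpow_def powr_def)

lemma exp_double_sum:
  fixes f :: "'n::finite \<Rightarrow> 'n \<Rightarrow> real"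
  shows "exp (\<Sum>i\<in>UNIV. \<Sum>j\<in>UNIV. f i j) = (\<Prod>i\<in>UNIV. \<Prod>j\<in>UNIV. exp (f i j))"
  by (simp add: exp_sum)

lemma prod_eq_exp_sum_ln:
  fixes f :: "'n::finite \<Rightarrow> real"
  assumes "\<And>i. 0 < f i"
  shows "(\<Prod>i\<in>UNIV. f i) = exp (\<Sum>i\<in>UNIV. ln (f i))"
  using assms by (simp add: exp_sum)

lemma RQ_ratio_eq_exp:
  fixes B C D x y :: "real^'n^'n"
  assumes C: "C \<in> pos_matrices" and D: "D \<in> pos_matrices"
    and x: "x \<in> pos_matrices" and y: "y \<in> pos_matrices"
  shows "RQ_ratio C D B x y =
    exp ((\<Sum>i\<in>UNIV. ln (\<Sum>j\<in>UNIV. x$i$j * C$i$j)) + (\<Sum>j\<in>UNIV. ln (\<Sum>i\<in>UNIV. y$i$j * D$i$j))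
      + (\<Sum>i\<in>UNIV. \<Sum>j\<in>UNIV. B$i$j * ln (B$i$j))
      + (\<Sum>i\<in>UNIV. \<Sum>j\<in>UNIV. (1 - B$i$j) * ln (1 - B$i$j))
      - (\<Sum>i\<in>UNIV. \<Sum>j\<in>UNIV. B$i$j * (ln (x$i$j) + ln (y$i$j))))"
proof -
  have pos: "0 < C$i$j" "0 < D$i$j" "0 < x$i$j" "0 < y$i$j" for i j
    using assms by (auto simp: pos_matrices_def)
  have "row_poly C x = exp (\<Sum>i\<in>UNIV. ln (\<Sum>j\<in>UNIV. x$i$j * C$i$j))"
    unfolding row_poly_def using pos by (intro prod_eq_exp_sum_ln sum_pos) auto
  moreover have "col_poly D y = exp (\<Sum>j\<in>UNIV. ln (\<Sum>i\<in>UNIV. y$i$j * D$i$j))"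
    unfolding col_poly_def using pos by (intro prod_eq_exp_sum_ln sum_pos) auto
  moreover have "rpow (x$i$j * y$i$j) (B$i$j) = exp (B$i$j * (ln (x$i$j) + ln (y$i$j)))" for i j
    using pos[of i j] by (simp add: rpow_eq_exp ln_mult)
  ultimately show ?thesis
    unfolding RQ_ratio_def by (simp add: rpow_eq_exp exp_add exp_diff exp_double_sum)
qed

lemma RO_sum_eq:
  fixes A B C D :: "real^'n^'n"
  assumes C: "C \<in> pos_matrices" and D: "D \<in> pos_matrices"
    and A: "\<And>i j. A$i$j = C$i$j * D$i$j" and B: "B \<in> doubly_stochastic"
  shows "RO_sum A B =
    (\<Sum>i\<in>UNIV. \<Sum>j\<in>UNIV. B$i$j * (ln (C$i$j) + ln (D$i$j) - ln (B$i$j)))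
    + (\<Sum>i\<in>UNIV. \<Sum>j\<in>UNIV. (1 - B$i$j) * ln (1 - B$i$j))"
proof -
  have "B$i$j * ln (A$i$j / B$i$j) = B$i$j * (ln (C$i$j) + ln (D$i$j) - ln (B$i$j))" for i j
  proof (cases "B$i$j = 0")
    case False
    moreover have "0 < C$i$j" "0 < D$i$j" "0 \<le> B$i$j"
      using C D B by (auto simp: pos_matrices_def doubly_stochastic_def)
    ultimately show ?thesis by (simp add: A ln_div ln_mult)
  qed simp
  then show ?thesis unfolding RO_sum_def sum.distrib by (simp only:)
qed

text \<open>On adding the row and column bounds, the terms in \<open>ln (x$i$j)\<close> and
  \<open>ln (y$i$j)\<close> cancel against the denominator. Each bound contributes
  \<open>- B$i$j * ln (B$i$j)\<close>; the numerator gives one of them back, leaving the single one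
  in \<open>RO_sum\<close>.\<close>

lemma exp_RO_sum_le_RQ_ratio:
  fixes A B C D x y :: "real^'n^'n"
  assumes C: "C \<in> pos_matrices" and D: "D \<in> pos_matrices"
    and A: "\<And>i j. A$i$j = C$i$j * D$i$j" and B: "B \<in> doubly_stochastic"
    and x: "x \<in> pos_matrices" and y: "y \<in> pos_matrices"
  shows "exp (RO_sum A B) \<le> RQ_ratio C D B x y"
proof -
  have pos: "0 < C$i$j" "0 < D$i$j" "0 < x$i$j" "0 < y$i$j" for i j
    using C D x y by (auto simp: pos_matrices_def)
  have B': "0 \<le> B$i$j" "(\<Sum>j\<in>UNIV. B$i$j) = 1" "(\<Sum>i\<in>UNIV. B$i$j) = 1" for i j
    using B by (auto simp: doubly_stochastic_def)
  have "(\<Sum>j\<in>UNIV. B$i$j * (ln (x$i$j * C$i$j) - ln (B$i$j))) \<le> ln (\<Sum>j\<in>UNIV. x$i$j * C$i$j)" for i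
    using pos B' by (intro gibbs_ln_sum) auto
  then have row: "(\<Sum>i\<in>UNIV. \<Sum>j\<in>UNIV. B$i$j * (ln (x$i$j) + ln (C$i$j) - ln (B$i$j)))
      \<le> (\<Sum>i\<in>UNIV. ln (\<Sum>j\<in>UNIV. x$i$j * C$i$j))"
    using pos by (intro sum_mono) (simp add: ln_mult_pos)
  have "(\<Sum>i\<in>UNIV. B$i$j * (ln (y$i$j * D$i$j) - ln (B$i$j))) \<le> ln (\<Sum>i\<in>UNIV. y$i$j * D$i$j)" for j
    using pos B' by (intro gibbs_ln_sum) auto
  then have "(\<Sum>j\<in>UNIV. \<Sum>i\<in>UNIV. B$i$j * (ln (y$i$j) + ln (D$i$j) - ln (B$i$j)))
      \<le> (\<Sum>j\<in>UNIV. ln (\<Sum>i\<in>UNIV. y$i$j * D$i$j))"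
    using pos by (intro sum_mono) (simp add: ln_mult_pos)
  then have col: "(\<Sum>i\<in>UNIV. \<Sum>j\<in>UNIV. B$i$j * (ln (y$i$j) + ln (D$i$j) - ln (B$i$j)))
      \<le> (\<Sum>j\<in>UNIV. ln (\<Sum>i\<in>UNIV. y$i$j * D$i$j))"
    by (subst sum.swap)
  show ?thesis
    unfolding RQ_ratio_eq_exp[OF C D x y] RO_sum_eq[OF C D A B] exp_le_cancel_iff
    using row col by (simp add: algebra_simps sum.distrib sum_subtractf)
qed

text \<open>Each of the \<open>n\<close> row factors and \<open>n\<close> column factors becomes
  \<open>1 + n * e\<close>, whose logarithm is at most \<open>n * e\<close>; together they cost
  \<open>2 * n\<^sup>2 * e\<close> in the exponent.\<close>

lemma RQ_ratio_perturbed_le: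
  fixes A B C D :: "real^'n^'n"
  assumes C: "C \<in> pos_matrices" and D: "D \<in> pos_matrices"
    and A: "\<And>i j. A$i$j = C$i$j * D$i$j" and B: "B \<in> doubly_stochastic" and e: "0 < e"
  shows "RQ_ratio C D B (\<chi> i j. (B$i$j + e) / C$i$j) (\<chi> i j. (B$i$j + e) / D$i$j)
    \<le> exp (RO_sum A B + 2 * (real CARD('n))\<^sup>2 * e)"
proof -
  define x y :: "real^'n^'n"
    where "x = (\<chi> i j. (B$i$j + e) / C$i$j)" and "y = (\<chi> i j. (B$i$j + e) / D$i$j)"
  have B': "0 \<le> B$i$j" "(\<Sum>j\<in>UNIV. B$i$j) = 1" "(\<Sum>i\<in>UNIV. B$i$j) = 1" for i j
    using B by (auto simp: doubly_stochastic_def)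
  have pos: "0 < C$i$j" "0 < D$i$j" "0 < B$i$j + e" for i j
    using C D B'(1)[of i j] e by (auto simp: pos_matrices_def)
  have x: "x \<in> pos_matrices" and y: "y \<in> pos_matrices"
    using pos by (auto simp: pos_matrices_def x_def y_def)
  have nz: "C$i$j \<noteq> 0" "D$i$j \<noteq> 0" for i j
    using pos[of i j] by auto
  have ln1: "ln (1 + real CARD('n) * e) \<le> real CARD('n) * e"
    using e by (intro ln_add_one_self_le_self) simp
  have "(\<Sum>j\<in>UNIV. x$i$j * C$i$j) = 1 + real CARD('n) * e" for i
    using B' nz by (simp add: x_def sum.distrib)
  then have row: "(\<Sum>i\<in>UNIV. ln (\<Sum>j\<in>UNIV. x$i$j * C$i$j)) \<le> (real CARD('n))\<^sup>2 * e"
    using ln1 by (simp add: power2_eq_square)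
  have "(\<Sum>i\<in>UNIV. y$i$j * D$i$j) = 1 + real CARD('n) * e" for j
    using B' nz by (simp add: y_def sum.distrib)
  then have col: "(\<Sum>j\<in>UNIV. ln (\<Sum>i\<in>UNIV. y$i$j * D$i$j)) \<le> (real CARD('n))\<^sup>2 * e"
    using ln1 by (simp add: power2_eq_square)
  \<comment> \<open>The shift by \<open>e\<close> only enlarges the denominator of the ratio. Where
    \<open>B$i$j = 0\<close> the weight removes the term in \<open>ln e\<close>.\<close>
  have "B$i$j * (2 * ln (B$i$j) - ln (C$i$j) - ln (D$i$j)) \<le> B$i$j * (ln (x$i$j) + ln (y$i$j))" for i j
  proof (cases "B$i$j = 0")
    case False
    then have "ln (B$i$j) \<le> ln (B$i$j + e)"
      using B'(1)[of i j] e by simp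
    moreover have "ln (x$i$j) = ln (B$i$j + e) - ln (C$i$j)" "ln (y$i$j) = ln (B$i$j + e) - ln (D$i$j)"
      using pos[of i j] by (simp_all add: x_def y_def ln_div)
    ultimately show ?thesis using B'(1)[of i j] by (intro mult_left_mono) auto
  qed simp
  then have "(\<Sum>i\<in>UNIV. \<Sum>j\<in>UNIV. B$i$j * (2 * ln (B$i$j) - ln (C$i$j) - ln (D$i$j)))
      \<le> (\<Sum>i\<in>UNIV. \<Sum>j\<in>UNIV. B$i$j * (ln (x$i$j) + ln (y$i$j)))"
    by (intro sum_mono)
  then have "RQ_ratio C D B x y \<le> exp (RO_sum A B + 2 * (real CARD('n))\<^sup>2 * e)"
    unfolding RQ_ratio_eq_exp[OF C D x y] RO_sum_eq[OF C D A B] exp_le_cancel_iff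
    using row col by (simp add: algebra_simps sum.distrib sum_subtractf flip: sum_distrib_left)
  then show ?thesis by (simp add: x_def y_def)
qed

lemma INF_RQ_ratio:
  fixes A B C D :: "real^'n^'n"
  assumes C: "C \<in> pos_matrices" and D: "D \<in> pos_matrices"
    and A: "\<And>i j. A$i$j = C$i$j * D$i$j" and B: "B \<in> doubly_stochastic"
  shows "(INF (x, y)\<in>pos_matrices \<times> pos_matrices. RQ_ratio C D B x y) = exp (RO_sum A B)"
    (is "?I = _")
proof (rule antisym)
  show "exp (RO_sum A B) \<le> ?I"
    using pos_matrices_nonempty
    by (intro cINF_greatest) (auto intro: exp_RO_sum_le_RQ_ratio[OF C D A B])
  have le: "?I \<le> exp (RO_sum A B + 2 * (real CARD('n))\<^sup>2 * e)" if e: "0 < e" for e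
  proof -
    let ?x = "(\<chi> i j. (B$i$j + e) / C$i$j) :: real^'n^'n"
    let ?y = "(\<chi> i j. (B$i$j + e) / D$i$j) :: real^'n^'n"
    have "0 \<le> B$i$j" for i j using B by (simp add: doubly_stochastic_def)
    then have "?x \<in> pos_matrices" "?y \<in> pos_matrices"
      using C D e by (auto simp: pos_matrices_def add_nonneg_pos)
    then have "?I \<le> RQ_ratio C D B ?x ?y"
      using cINF_lower[OF RQ_ratio_bdd_below[OF C D], of "(?x, ?y)"] by simp
    also have "\<dots> \<le> exp (RO_sum A B + 2 * (real CARD('n))\<^sup>2 * e)"
      by (rule RQ_ratio_perturbed_le[OF C D A B e])
    finally show ?thesis .
  qed
  \<comment> \<open>The infimum need not be attained, so the bound is passed to the limit as
    \<open>e\<close> tends to 0 from the right.\<close>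
  have "((\<lambda>e. exp (RO_sum A B + 2 * (real CARD('n))\<^sup>2 * e)) \<longlongrightarrow>
      exp (RO_sum A B + 2 * (real CARD('n))\<^sup>2 * 0)) (at_right 0)"
    by (intro tendsto_intros)
  moreover have "\<forall>\<^sub>F e in at_right 0. ?I \<le> exp (RO_sum A B + 2 * (real CARD('n))\<^sup>2 * e)"
    by (auto simp: eventually_at_filter le)
  ultimately show "?I \<le> exp (RO_sum A B)"
    using tendsto_lowerbound[of _ _ "at_right (0::real)" ?I] by simp
qed

theorem theorem3:
  fixes A C D :: "real^'n^'n"
  assumes "\<And>i j. 0 < C$i$j"
    and "\<And>i j. 0 < D$i$j"
    and "\<And>i j. A$i$j = C$i$j * D$i$j"
  shows "R_Q C D = exp (R_O A)"
proof -
  have C: "C \<in> pos_matrices" and D: "D \<in> pos_matrices" and A: "A \<in> pos_matrices"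
    using assms by (auto simp: pos_matrices_def)
  have "R_Q C D = (SUP B\<in>doubly_stochastic. exp (RO_sum A B))"
    unfolding R_Q_def by (intro SUP_cong refl INF_RQ_ratio[OF C D assms(3)])
  also have "\<dots> = exp (SUP B\<in>doubly_stochastic. RO_sum A B)"
    \<comment> \<open>A real supremum is meaningful only for a nonempty set bounded above; both
      facts are needed to move \<open>exp\<close> through it.\<close>
    using continuous_at_Sup_mono[of exp "RO_sum A ` doubly_stochastic"]
      RO_bdd_above[OF A] doubly_stochastic_nonempty[where 'n = 'n]
    by (simp add: mono_def continuous_at_imp_continuous_at_within image_image)
  finally show ?thesis by (simp add: R_O_def)
qed

end
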